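(* Let $\mu$ be a complex number with $\Re(\mu)>0$ and let $n\geq 1$ be an integer. Then $$\sum_{k=0}^{n} \binom{n+k}{2k} \binom{2k}{k} \frac{(-1)^k}{(n+k)(2k+2\mu)} = \frac{(-1)^n}{4n} \left(\frac{\Gamma^2(\mu)}{\Gamma(\mu+n+1)\Gamma(\mu-n)} - \frac{\Gamma^2(\mu)}{\Gamma(\mu+n)\Gamma(\mu+1-n)}\right).$$
   Context: $\Gamma$ denotes the Gamma function, $\Gamma(z)=\int_0^\infty e^{-t}t^{z-1}\,dt$ for $\Re(z)>0$, extended meromorphically to $\mathbb{C}$ with simple poles at $z=0,-1,-2,\ldots$. The reciprocal $1/\Gamma(z)$ is the entire function that takes the value $0$ at $z=0,-1,-2,\ldots$, so a term containing $1/\Gamma$ at such a point is $0$. $\Gamma^2(\mu)$ means $(\Gamma(\mu))^2$. *)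

theory Defs
  imports "HOL-Analysis.Gamma_Function"
begin

end

theory Submission
  imports Defs
begin

text \<open>
  Both sides are the same rational function of \<open>\<mu>\<close>, once in partial fractions and once in product
  form. Writing \<open>(x)\<^sub>m\<close> for the Pochhammer symbol, the functional equation
  \<open>rGamma z = (z)\<^sub>m rGamma (z + m)\<close> turns the right-hand side into
  \<open>(1 - \<mu>)\<^sub>n\<^sub>-\<^sub>1 / (2 (\<mu>)\<^sub>n\<^sub>+\<^sub>1)\<close>, whose poles are the simple ones at \<open>-k\<close> for \<open>k \<le> n\<close>.
  The binomial product on the left equals \<open>(n + k) (n choose k) (k + 1)\<^sub>n\<^sub>-\<^sub>1 / n!\<close>, so the left-hand
  side is, up to a constant factor, an \<open>n\<close>-th finite difference of \<open>k \<mapsto> (k + 1)\<^sub>n\<^sub>-\<^sub>1 / (k + \<mu>)\<close>.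

  The partial fraction expansion (\<open>alternating_binomial_sum_pochhammer_over_linear\<close>) rests on the
  fact that an \<open>n\<close>-th difference kills polynomials of degree below \<open>n\<close>
  (\<open>alternating_binomial_sum_pochhammer_eq_0\<close>): modulo such polynomials the numerator
  \<open>(k + 1)\<^sub>m\<close> over \<open>k + \<mu>\<close> may be replaced by its value at \<open>k = -\<mu>\<close>, which leaves the
  \<open>n\<close>-th difference of \<open>1 / (k + \<mu>)\<close> (\<open>alternating_binomial_sum_inverse\<close>).
\<close>

text \<open>
  By Pascal's rule, an alternating binomial sum of order \<open>n + 1\<close> is one of order \<open>n\<close> for the
  (negated) forward difference; this drives the inductions below.
\<close>

lemma alternating_binomial_sum_Suc:
  fixes f :: "nat \<Rightarrow> 'a :: comm_ring_1"
  shows "(\<Sum>k\<le>Suc n. (-1) ^ k * of_nat (Suc n choose k) * f k) =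
         (\<Sum>k\<le>n. (-1) ^ k * of_nat (n choose k) * (f k - f (Suc k)))"
proof -
  have "(\<Sum>k\<le>Suc n. (-1) ^ k * of_nat (Suc n choose k) * f k) =
        f 0 + (\<Sum>k\<le>n. (-1) ^ Suc k * of_nat (n choose Suc k) * f (Suc k))
            - (\<Sum>k\<le>n. (-1) ^ k * of_nat (n choose k) * f (Suc k))"
    by (subst sum.atMost_Suc_shift) (simp add: algebra_simps sum.distrib sum_negf sum_subtractf)
  also have "f 0 + (\<Sum>k\<le>n. (-1) ^ Suc k * of_nat (n choose Suc k) * f (Suc k)) =
             (\<Sum>k\<le>Suc n. (-1) ^ k * of_nat (n choose k) * f k)"
    by (subst sum.atMost_Suc_shift) simp
  also have "\<dots> = (\<Sum>k\<le>n. (-1) ^ k * of_nat (n choose k) * f k)"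
    by (simp add: binomial_eq_0)
  finally show ?thesis
    by (simp add: algebra_simps sum_subtractf)
qed

lemma pochhammer_forward_difference:
  fixes a :: "'a :: comm_ring_1"
  shows "pochhammer a (Suc m) - pochhammer (a + 1) (Suc m) = - of_nat (Suc m) * pochhammer (a + 1) m"
  unfolding pochhammer_rec[of a] pochhammer_Suc[of "a + 1"] by (simp add: algebra_simps)

text \<open>
  The base point \<open>a\<close> is kept general because each difference shifts it by one while lowering
  the degree.
\<close>

lemma alternating_binomial_sum_pochhammer_eq_0:
  fixes a :: "'a :: comm_ring_1"
  assumes "m < n"
  shows "(\<Sum>k\<le>n. (-1) ^ k * of_nat (n choose k) * pochhammer (a + of_nat k) m) = 0"
  using assms
proof (induction n arbitrary: m a)
  case 0
  then show ?case by simp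
next
  case (Suc n)
  show ?case
  proof (cases m)
    case 0
    then show ?thesis
      by (subst alternating_binomial_sum_Suc) simp
  next
    case (Suc m')
    have diff: "pochhammer (a + of_nat k) m - pochhammer (a + of_nat (Suc k)) m =
                - of_nat m * pochhammer (a + 1 + of_nat k) m'" for k
      using pochhammer_forward_difference[of "a + of_nat k" m'] Suc
      by (simp add: add_ac)
    have "(\<Sum>k\<le>Suc n. (-1) ^ k * of_nat (Suc n choose k) * pochhammer (a + of_nat k) m) =
          - of_nat m * (\<Sum>k\<le>n. (-1) ^ k * of_nat (n choose k) * pochhammer (a + 1 + of_nat k) m')"
      unfolding alternating_binomial_sum_Suc diff sum_distrib_left
      by (intro sum.cong) (simp_all add: mult_ac)
    also have "\<dots> = 0"
      using Suc.IH[of m' "a + 1"] Suc.prems Suc by simp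
    finally show ?thesis .
  qed
qed

lemma alternating_binomial_sum_inverse:
  fixes x :: "'a :: field_char_0"
  assumes "pochhammer x (Suc n) \<noteq> 0"
  shows "(\<Sum>k\<le>n. (-1) ^ k * of_nat (n choose k) * (1 / (of_nat k + x))) =
         fact n / pochhammer x (Suc n)"
  using assms
proof (induction n arbitrary: x)
  case 0
  then show ?case by simp
next
  case (Suc n)
  have left: "pochhammer x (Suc (Suc n)) = pochhammer x (Suc n) * (x + of_nat (Suc n))"
    by (simp add: pochhammer_Suc)
  have right: "pochhammer x (Suc (Suc n)) = x * pochhammer (x + 1) (Suc n)"
    by (rule pochhammer_rec)
  have nz: "pochhammer x (Suc n) \<noteq> 0" "x + of_nat (Suc n) \<noteq> 0"
           "x \<noteq> 0" "pochhammer (x + 1) (Suc n) \<noteq> 0"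
    using Suc.prems[unfolded left] Suc.prems[unfolded right] by (simp_all del: of_nat_Suc)
  have "(\<Sum>k\<le>Suc n. (-1) ^ k * of_nat (Suc n choose k) * (1 / (of_nat k + x))) =
        fact n / pochhammer x (Suc n) - fact n / pochhammer (x + 1) (Suc n)"
    unfolding alternating_binomial_sum_Suc
    using Suc.IH[OF nz(1)] Suc.IH[OF nz(4)]
    by (simp add: right_diff_distrib sum_subtractf add_ac)
  also have "fact n / pochhammer x (Suc n) =
             fact n * (x + of_nat (Suc n)) / pochhammer x (Suc (Suc n))"
    using nz unfolding left by simp
  also have "fact n / pochhammer (x + 1) (Suc n) = fact n * x / pochhammer x (Suc (Suc n))"
    using nz unfolding right by simp
  also have "fact n * (x + of_nat (Suc n)) / pochhammer x (Suc (Suc n)) -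
             fact n * x / pochhammer x (Suc (Suc n)) =
             fact (Suc n) / pochhammer x (Suc (Suc n))"
    by (simp add: algebra_simps flip: diff_divide_distrib)
  finally show ?case .
qed

text \<open>
  Going from \<open>m\<close> to \<open>m + 1\<close> multiplies the numerator by \<open>k + 1 + m = (k + x) + (1 - x + m)\<close>. The
  first summand cancels the denominator and contributes a vanishing difference, the second
  is the next factor of \<open>pochhammer (1 - x) (m + 1)\<close>.
\<close>

lemma alternating_binomial_sum_pochhammer_over_linear:
  fixes x :: "'a :: field_char_0"
  assumes "pochhammer x (Suc n) \<noteq> 0" and "m \<le> n"
  shows "(\<Sum>k\<le>n. (-1) ^ k * of_nat (n choose k) * (pochhammer (1 + of_nat k) m / (of_nat k + x))) =
         fact n * pochhammer (1 - x) m / pochhammer x (Suc n)"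
  using assms(2)
proof (induction m)
  case 0
  then show ?case
    using alternating_binomial_sum_inverse[OF assms(1)] by simp
next
  case (Suc m)
  have split: "pochhammer (1 + of_nat k) (Suc m) / (of_nat k + x) =
          pochhammer (1 + of_nat k) m +
          (1 - x + of_nat m) * (pochhammer (1 + of_nat k) m / (of_nat k + x))"
    if "k \<le> n" for k
  proof -
    have "x \<noteq> - of_nat k"
      using assms(1) that by (auto simp: pochhammer_eq_0_iff)
    then have "of_nat k + x \<noteq> 0"
      by (metis add_eq_0_iff2 add.commute)
    then show ?thesis
      by (simp add: pochhammer_Suc divide_simps) (simp add: algebra_simps)
  qed
  have "(\<Sum>k\<le>n. (-1) ^ k * of_nat (n choose k) *
           (pochhammer (1 + of_nat k) (Suc m) / (of_nat k + x))) =
        (\<Sum>k\<le>n. (-1) ^ k * of_nat (n choose k) * pochhammer (1 + of_nat k) m) +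
        (1 - x + of_nat m) *
          (\<Sum>k\<le>n. (-1) ^ k * of_nat (n choose k) * (pochhammer (1 + of_nat k) m / (of_nat k + x)))"
    unfolding sum_distrib_left sum.distrib[symmetric]
    by (intro sum.cong refl, subst split) (simp_all add: ring_distribs mult_ac)
  also have "\<dots> = (1 - x + of_nat m) * (fact n * pochhammer (1 - x) m / pochhammer x (Suc n))"
    using alternating_binomial_sum_pochhammer_eq_0[of m n "1 :: 'a"] Suc by simp
  also have "\<dots> = fact n * pochhammer (1 - x) (Suc m) / pochhammer x (Suc n)"
    by (simp add: pochhammer_Suc)
  finally show ?case .
qed

text \<open>
  Both sides equal \<open>(n + k)! / ((n - k)! k! k!)\<close>; the order is written \<open>Suc m\<close> so that the
  predecessor \<open>n - 1\<close> is available without truncated subtraction.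
\<close>

lemma binomial_product_eq_pochhammer:
  assumes "k \<le> Suc m"
  shows "of_nat ((Suc m + k) choose (2 * k)) * of_nat ((2 * k) choose k) =
         of_nat (Suc m + k) * of_nat (Suc m choose k) * pochhammer (1 + of_nat k) m /
         (fact (Suc m) :: 'a :: field_char_0)"
proof -
  have "fact (k + m) = (fact k * pochhammer (1 + of_nat k) m :: 'a)"
    using pochhammer_product'[of "1 :: 'a" k m] by (simp add: pochhammer_fact)
  then have poch: "pochhammer (1 + of_nat k) m = (fact (k + m) / fact k :: 'a)"
    by simp
  have sub: "Suc m + k - 2 * k = Suc m - k" "2 * k - k = k"
    using assms by auto
  have fact: "(fact (Suc m + k) :: 'a) = of_nat (Suc m + k) * fact (k + m)"
    by (simp add: add_ac)
  have "of_nat ((Suc m + k) choose (2 * k)) * of_nat ((2 * k) choose k) =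
        (fact (Suc m + k) / (fact (Suc m - k) * fact k * fact k) :: 'a)"
    using assms by (simp add: binomial_fact sub del: fact_Suc)
  moreover have "of_nat (Suc m choose k) = (fact (Suc m) / (fact k * fact (Suc m - k)) :: 'a)"
    using assms by (rule binomial_fact)
  ultimately show ?thesis
    unfolding poch fact by (simp del: fact_Suc)
qed

text \<open>
  The two products of reciprocal Gamma values share the factor \<open>rGamma (\<mu> + n + 1) rGamma (\<mu> + 1 - n)\<close>
  with cofactors \<open>\<mu> - n\<close> and \<open>\<mu> + n\<close>, so their difference carries the factor \<open>-2 n\<close>.
\<close>

lemma Gamma_squared_difference_eq_pochhammer:
  fixes z :: complex
  assumes "z \<notin> \<int>\<^sub>\<le>\<^sub>0"
  shows "(Gamma z)\<^sup>2 * (rGamma (z + of_nat (Suc m) + 1) * rGamma (z - of_nat (Suc m))) -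
         (Gamma z)\<^sup>2 * (rGamma (z + of_nat (Suc m)) * rGamma (z + 1 - of_nat (Suc m))) =
         2 * of_nat (Suc m) * (-1) ^ Suc m *
           (pochhammer (1 - z) m / pochhammer z (Suc (Suc m)))"
proof -
  have inv: "Gamma z * rGamma z = 1"
    using assms by (simp add: Gamma_def rGamma_eq_zero_iff)
  have nz: "pochhammer z (Suc (Suc m)) \<noteq> 0"
    using assms by (auto simp: pochhammer_eq_0_iff)
  have up: "Gamma z * rGamma (z + of_nat (Suc m) + 1) = 1 / pochhammer z (Suc (Suc m))"
    using inv pochhammer_rGamma[of z "Suc (Suc m)"] nz by (simp add: field_simps)
  have "pochhammer (1 - z) m = (-1) ^ m * pochhammer (z - of_nat m) m"
    using pochhammer_minus[of "z - 1" m] by simp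
  then have "pochhammer (z - of_nat m) m = (-1) ^ m * pochhammer (1 - z) m"
    by (simp flip: mult.assoc power_add)
  then have "rGamma (z - of_nat m) = (-1) ^ m * pochhammer (1 - z) m * rGamma z"
    using pochhammer_rGamma[of "z - of_nat m" m] by simp
  then have down: "Gamma z * rGamma (z + 1 - of_nat (Suc m)) = (-1) ^ m * pochhammer (1 - z) m"
    using inv by (simp add: mult_ac)
  have step1: "rGamma (z - of_nat (Suc m)) =
               (z - of_nat (Suc m)) * rGamma (z + 1 - of_nat (Suc m))"
    using rGamma_plus1[of "z - of_nat (Suc m)"] by (simp add: algebra_simps)
  have step2: "rGamma (z + of_nat (Suc m)) =
               (z + of_nat (Suc m)) * rGamma (z + of_nat (Suc m) + 1)"
    by (rule rGamma_plus1[symmetric])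
  have "(Gamma z)\<^sup>2 * (rGamma (z + of_nat (Suc m) + 1) * rGamma (z - of_nat (Suc m))) -
        (Gamma z)\<^sup>2 * (rGamma (z + of_nat (Suc m)) * rGamma (z + 1 - of_nat (Suc m))) =
        - 2 * of_nat (Suc m) * (Gamma z * rGamma (z + of_nat (Suc m) + 1)) *
          (Gamma z * rGamma (z + 1 - of_nat (Suc m)))"
    unfolding step1 step2 by algebra
  then show ?thesis
    unfolding up down by (simp add: divide_simps) (simp add: algebra_simps)
qed

theorem theorem3p3:
  fixes \<mu> :: complex and n :: nat
  assumes "Re \<mu> > 0" and "n \<ge> 1"
  shows "(\<Sum>k = 0..n. of_nat ((n + k) choose (2 * k)) * of_nat ((2 * k) choose k) *
             ((-1) ^ k / (of_nat (n + k) * (2 * of_nat k + 2 * \<mu>)))) =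
         (-1) ^ n / (4 * of_nat n) *
           ((Gamma \<mu>)\<^sup>2 * (rGamma (\<mu> + of_nat n + 1) * rGamma (\<mu> - of_nat n)) -
            (Gamma \<mu>)\<^sup>2 * (rGamma (\<mu> + of_nat n) * rGamma (\<mu> + 1 - of_nat n)))"
proof -
  obtain m where n: "n = Suc m"
    using assms(2) by (cases n) auto
  have \<mu>: "\<mu> \<notin> \<int>\<^sub>\<le>\<^sub>0"
    using assms(1) by (auto elim!: nonpos_Ints_cases)
  then have nz: "pochhammer \<mu> (Suc n) \<noteq> 0"
    by (auto simp: pochhammer_eq_0_iff)
  have "of_nat ((n + k) choose (2 * k)) * of_nat ((2 * k) choose k) *
          ((-1) ^ k / (of_nat (n + k) * (2 * of_nat k + 2 * \<mu>))) =
        1 / (2 * fact n) *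
          ((-1) ^ k * of_nat (n choose k) * (pochhammer (1 + of_nat k) m / (of_nat k + \<mu>)))"
    if "k \<le> n" for k
  proof -
    have two: "2 * of_nat k + 2 * \<mu> = 2 * (of_nat k + \<mu>)"
      by simp
    have "(of_nat (n + k) :: complex) \<noteq> 0"
      using assms(2) by (simp del: of_nat_add)
    then show ?thesis
      unfolding two using binomial_product_eq_pochhammer[of k m, where 'a = complex] that
      by (simp add: n mult_ac del: of_nat_add of_nat_Suc fact_Suc distrib_left_numeral)
  qed
  then have "(\<Sum>k = 0..n. of_nat ((n + k) choose (2 * k)) * of_nat ((2 * k) choose k) *
               ((-1) ^ k / (of_nat (n + k) * (2 * of_nat k + 2 * \<mu>)))) =
             1 / (2 * fact n) * (\<Sum>k\<le>n. (-1) ^ k * of_nat (n choose k) *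
               (pochhammer (1 + of_nat k) m / (of_nat k + \<mu>)))"
    unfolding sum_distrib_left atLeast0AtMost by (intro sum.cong) auto
  also have "\<dots> = pochhammer (1 - \<mu>) m / (2 * pochhammer \<mu> (Suc n))"
    using alternating_binomial_sum_pochhammer_over_linear[OF nz, of m]
    by (simp add: n del: fact_Suc)
  also have "\<dots> = (-1) ^ n / (4 * of_nat n) *
               (2 * of_nat n * (-1) ^ n * (pochhammer (1 - \<mu>) m / pochhammer \<mu> (Suc n)))"
    using assms(2) by (simp add: field_simps flip: power_add)
  also have "2 * of_nat n * (-1) ^ n * (pochhammer (1 - \<mu>) m / pochhammer \<mu> (Suc n)) =
             (Gamma \<mu>)\<^sup>2 * (rGamma (\<mu> + of_nat n + 1) * rGamma (\<mu> - of_nat n)) -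
             (Gamma \<mu>)\<^sup>2 * (rGamma (\<mu> + of_nat n) * rGamma (\<mu> + 1 - of_nat n))"
    unfolding n by (rule Gamma_squared_difference_eq_pochhammer[OF \<mu>, symmetric])
  finally show ?thesis .
qed

end
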